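(* Let $x_1,\dots,x_6$ be indeterminates over $\mathbb{C}$. Let $P$ be the set of all permutations $\sigma=(\sigma_1,\dots,\sigma_6)$ of $\{1,\dots,6\}$ (in line notation) such that, writing $p_i=\sigma^{-1}(i)$ for the position of $i$ in $\sigma$, $$p_1<p_2,\quad p_1<p_4,\quad p_6<p_2,\quad p_6<p_4,\quad p_2<p_3,\quad p_2<p_5,\quad p_4<p_3,\quad p_4<p_5 .$$ Then, in the field of rational functions $\mathbb{C}(x_1,\dots,x_6)$, $$\sum_{\sigma\in P}\mathrm{PT}(\sigma)=\frac{N^2}{D},$$ where $$N=x_1 x_2 x_4-x_2 x_3 x_4-x_2 x_4 x_5+x_3 x_4 x_5-x_1 x_4 x_6+x_2 x_4 x_6-x_1 x_3 x_5+x_2 x_3 x_5-x_1 x_2 x_6+x_1 x_3 x_6+x_1 x_5 x_6-x_3 x_5 x_6$$ and $$D=(x_1-x_2)(x_1-x_3)(x_2-x_3)(x_1-x_4)(x_3-x_4)(x_1-x_5)(x_2-x_5)(x_4-x_5)(x_2-x_6)(x_3-x_6)(x_4-x_6)(x_5-x_6).$$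
   Context: For a permutation $\sigma=(\sigma_1,\dots,\sigma_6)$ of $\{1,\dots,6\}$, the (cyclically invariant) Parke-Taylor factor is $$\mathrm{PT}(\sigma)=\frac{1}{(x_{\sigma_1}-x_{\sigma_2})(x_{\sigma_2}-x_{\sigma_3})(x_{\sigma_3}-x_{\sigma_4})(x_{\sigma_4}-x_{\sigma_5})(x_{\sigma_5}-x_{\sigma_6})(x_{\sigma_6}-x_{\sigma_1})}.$$ *)

theory Defs
  imports
    Complex_Main
    "HOL-Library.Poly_Mapping"
    "HOL-Library.Numeral_Type"
    "HOL-Computational_Algebra.Fraction_Field"
    "HOL-Combinatorics.Permutations"
begin

text \<open>
  A monomial in six variables is an exponent vector of type \<open>6 \<Rightarrow>\<^sub>0 nat\<close>, and a polynomial is a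
  finitely supported family of complex coefficients indexed by monomials, with the convolution
  product of \<^theory>\<open>HOL-Library.Poly_Mapping\<close>. The index type \<open>6\<close> consists of the residues
  modulo \<open>6\<close>, so the index of the sixth variable is \<open>0 = 6\<close>.
\<close>

type_synonym poly6 = "(6 \<Rightarrow>\<^sub>0 nat) \<Rightarrow>\<^sub>0 complex"

type_synonym ratfun6 = "poly6 fract"

definition indet_poly :: "nat \<Rightarrow> poly6" where
  "indet_poly i = Poly_Mapping.single (Poly_Mapping.single (of_nat i) 1) 1"

text \<open>Only the indices \<open>1, \<dots>, 6\<close> are meant; on these the indeterminates are pairwise distinct.\<close>

definition indet :: "nat \<Rightarrow> ratfun6" where
  "indet i = Fraction_Field.Fract (indet_poly i) 1"

lemma inj_on_indet: "inj_on indet {1..6}"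
proof (rule inj_onI)
  fix i j :: nat
  assume ij: "i \<in> {1..6}" "j \<in> {1..6}" and "indet i = indet j"
  then have "indet_poly i = indet_poly j"
    by (simp add: indet_def eq_fract)
  then have "Poly_Mapping.lookup (indet_poly i) (Poly_Mapping.single (of_nat i) 1)
      = Poly_Mapping.lookup (indet_poly j) (Poly_Mapping.single (of_nat i) 1)"
    by simp
  then have "Poly_Mapping.single (of_nat j :: 6) (1 :: nat) = Poly_Mapping.single (of_nat i) 1"
    by (simp add: indet_poly_def lookup_single when_def split: if_splits)
  then have "Poly_Mapping.lookup (Poly_Mapping.single (of_nat j :: 6) (1 :: nat)) (of_nat i)
      = Poly_Mapping.lookup (Poly_Mapping.single (of_nat i) 1) (of_nat i :: 6)"
    by simp
  then have eq: "(of_nat i :: 6) = of_nat j"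
    by (simp add: lookup_single when_def split: if_splits)
  have "i \<in> {1, 2, 3, 4, 5, 6}" "j \<in> {1, 2, 3, 4, 5, 6}"
    using ij by auto
  then show "i = j"
    using eq by auto
qed

text \<open>A permutation in line notation \<open>(\<sigma>\<^sub>1, \<dots>, \<sigma>\<^sub>6)\<close> is the function \<open>\<sigma>\<close> with \<open>\<sigma> i = \<sigma>\<^sub>i\<close>.\<close>

definition parke_taylor :: "(nat \<Rightarrow> nat) \<Rightarrow> ratfun6" where
  "parke_taylor \<sigma> = 1 /
    ((indet (\<sigma> 1) - indet (\<sigma> 2)) * (indet (\<sigma> 2) - indet (\<sigma> 3)) *
     (indet (\<sigma> 3) - indet (\<sigma> 4)) * (indet (\<sigma> 4) - indet (\<sigma> 5)) *
     (indet (\<sigma> 5) - indet (\<sigma> 6)) * (indet (\<sigma> 6) - indet (\<sigma> 1)))"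

definition perm_set :: "(nat \<Rightarrow> nat) set" where
  "perm_set = {\<sigma>. \<sigma> permutes {1..6} \<and>
     (let p = inv \<sigma> in
        p 1 < p 2 \<and> p 1 < p 4 \<and> p 6 < p 2 \<and> p 6 < p 4 \<and>
        p 2 < p 3 \<and> p 2 < p 5 \<and> p 4 < p 3 \<and> p 4 < p 5)}"

end

(* The eight relations say that \<sigma> lists first {1, 6}, then {2, 4}, then {3, 5}, so that P has
   eight elements. Adding the two terms that differ in the order of the last block cancels the
   pole at x3 = x5; the four resulting fractions, over the common denominator
   (x1 - x6) (x2 - x4) D, have a numerator divisible by (x1 - x6) (x2 - x4) with quotient N^2. *)

theory Submission
  imports Defs
begin

text \<open>Grouping the six entries in pairs lets the set P appear as a product of three
  two-element sets. Starting from \<open>id\<close> gives the fixed points outside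
  \<open>{1..6}\<close> that \<open>permutes\<close> demands.\<close>

definition line_notation :: "(nat \<times> nat) \<times> (nat \<times> nat) \<times> (nat \<times> nat) \<Rightarrow> nat \<Rightarrow> nat" where
  "line_notation = (\<lambda>((a, b), (c, d), (e, f)). id(1 := a, 2 := b, 3 := c, 4 := d, 5 := e, 6 := f))"

definition blocks :: "((nat \<times> nat) \<times> (nat \<times> nat) \<times> (nat \<times> nat)) set" where
  "blocks = {(1, 6), (6, 1)} \<times> {(2, 4), (4, 2)} \<times> {(3, 5), (5, 3)}"

lemma atLeastAtMost_1_6: "{1..6::nat} = {1, 2, 3, 4, 5, 6}"
  by auto

lemma line_notation_in_perm_set:
  assumes "t \<in> blocks"
  shows "line_notation t \<in> perm_set"
proof -
  have "bij_betw (line_notation t) {1..6} {1..6}"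
    using assms unfolding blocks_def line_notation_def atLeastAtMost_1_6 bij_betw_def
    by (elim SigmaE insertE emptyE; simp; blast)
  then have perm: "line_notation t permutes {1..6}"
    by (rule bij_imp_permutes) (auto simp: line_notation_def split: prod.splits)
  \<comment> \<open>Positions are read off from values, so the eight order relations become
    comparisons of numerals.\<close>
  have pos: "inv (line_notation t) j = i" if "line_notation t i = j" for i j
    using permutes_inv_eq[OF perm] that by simp
  show ?thesis
    using assms perm pos[of 1 "line_notation t 1"] pos[of 2 "line_notation t 2"]
      pos[of 3 "line_notation t 3"] pos[of 4 "line_notation t 4"]
      pos[of 5 "line_notation t 5"] pos[of 6 "line_notation t 6"]
    unfolding perm_set_def Let_def blocks_def
    by (auto simp: line_notation_def)
qed

text \<open>The relations put 1 and 6 before 2 and 4, and these before 3 and 5; with only six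
  positions, each pair must fill two consecutive ones.\<close>

lemma perm_set_in_blocks:
  assumes "\<sigma> \<in> perm_set"
  shows "((\<sigma> 1, \<sigma> 2), (\<sigma> 3, \<sigma> 4), (\<sigma> 5, \<sigma> 6)) \<in> blocks"
proof -
  define p where "p = inv \<sigma>"
  have perm: "\<sigma> permutes {1..6}"
    and ord: "p 1 < p 2" "p 1 < p 4" "p 6 < p 2" "p 6 < p 4"
      "p 2 < p 3" "p 2 < p 5" "p 4 < p 3" "p 4 < p 5"
    using assms by (auto simp: perm_set_def p_def Let_def)
  have p_range: "p i \<in> {1..6}" if "i \<in> {1..6}" for i
    using permutes_in_image[OF permutes_inv[OF perm]] that by (simp add: p_def)
  have \<sigma>_p: "\<sigma> (p i) = i" for i
    using permutes_inverses[OF perm] by (simp add: p_def)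
  \<comment> \<open>Equal positions would carry equal entries. These three pairs are the ones that
    the order relations leave incomparable.\<close>
  have neq: "p 1 \<noteq> p 6" "p 2 \<noteq> p 4" "p 3 \<noteq> p 5"
    using \<sigma>_p[of 1] \<sigma>_p[of 6] \<sigma>_p[of 2] \<sigma>_p[of 4] \<sigma>_p[of 3] \<sigma>_p[of 5] by force+
  have "1 \<le> p 1" "1 \<le> p 6" "p 3 \<le> 6" "p 5 \<le> 6"
    using p_range[of 1] p_range[of 6] p_range[of 3] p_range[of 5] by auto
  \<comment> \<open>The larger of \<open>p 1\<close>, \<open>p 6\<close> is at least 2, and the
    smaller of \<open>p 3\<close>, \<open>p 5\<close> is at most 5; \<open>p 2\<close> and
    \<open>p 4\<close> lie strictly between.\<close>
  moreover from this have "3 \<le> p 2" "3 \<le> p 4" "p 2 \<le> 4" "p 4 \<le> 4"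
    using ord neq by linarith+
  ultimately have p_cases: "p 1 = 1 \<and> p 6 = 2 \<or> p 1 = 2 \<and> p 6 = 1"
    "p 2 = 3 \<and> p 4 = 4 \<or> p 2 = 4 \<and> p 4 = 3" "p 3 = 5 \<and> p 5 = 6 \<or> p 3 = 6 \<and> p 5 = 5"
    using ord neq by linarith+
  have "(\<sigma> 1, \<sigma> 2) \<in> {(1, 6), (6, 1)}"
    using p_cases(1) \<sigma>_p[of 1] \<sigma>_p[of 6] by (elim disjE conjE) simp_all
  moreover have "(\<sigma> 3, \<sigma> 4) \<in> {(2, 4), (4, 2)}"
    using p_cases(2) \<sigma>_p[of 2] \<sigma>_p[of 4] by (elim disjE conjE) simp_all
  moreover have "(\<sigma> 5, \<sigma> 6) \<in> {(3, 5), (5, 3)}"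
    using p_cases(3) \<sigma>_p[of 3] \<sigma>_p[of 5] by (elim disjE conjE) simp_all
  ultimately show ?thesis
    unfolding blocks_def by blast
qed

text \<open>Reading off the six values and \<open>line_notation\<close> are mutually inverse between
  \<open>perm_set\<close> and \<open>blocks\<close>.\<close>

lemma sum_perm_set: "(\<Sum>\<sigma>\<in>perm_set. F \<sigma>) = (\<Sum>t\<in>blocks. F (line_notation t))"
proof (rule sum.reindex_bij_witness[where i = line_notation and
      j = "\<lambda>\<sigma>. ((\<sigma> 1, \<sigma> 2), (\<sigma> 3, \<sigma> 4), (\<sigma> 5, \<sigma> 6))"])
  fix \<sigma>
  assume \<sigma>: "\<sigma> \<in> perm_set"
  then have "\<sigma> i = i" if "i \<notin> {1..6}" for i
    using that by (auto simp: perm_set_def permutes_def)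
  then show *: "line_notation ((\<sigma> 1, \<sigma> 2), (\<sigma> 3, \<sigma> 4), (\<sigma> 5, \<sigma> 6)) = \<sigma>"
    by (auto simp: line_notation_def fun_eq_iff)
  show "F (line_notation ((\<sigma> 1, \<sigma> 2), (\<sigma> 3, \<sigma> 4), (\<sigma> 5, \<sigma> 6))) = F \<sigma>"
    by (simp only: *)
  show "((\<sigma> 1, \<sigma> 2), (\<sigma> 3, \<sigma> 4), (\<sigma> 5, \<sigma> 6)) \<in> blocks"
    using \<sigma> by (rule perm_set_in_blocks)
next
  fix t
  assume "t \<in> blocks"
  then show "line_notation t \<in> perm_set"
    by (rule line_notation_in_perm_set)
  show "((line_notation t 1, line_notation t 2), (line_notation t 3, line_notation t 4),
      (line_notation t 5, line_notation t 6)) = t"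
    by (cases t) (auto simp: line_notation_def)
qed

lemma parke_taylor_line_notation:
  "parke_taylor (line_notation ((a, b), (c, d), (e, f))) =
    1 / ((indet a - indet b) * (indet b - indet c) * (indet c - indet d) *
      (indet d - indet e) * (indet e - indet f) * (indet f - indet a))"
  by (simp add: parke_taylor_def line_notation_def)

text \<open>Here \<open>r\<close> stands for the factors of the cycle from \<open>a\<close> to
  \<open>d\<close>. The pole at \<open>e = f\<close> cancels because (d - f)(e - a) - (d - e)(f - a)
  = (e - f)(d - a).\<close>

lemma sum_swap_last:
  fixes a d e f r :: "'a::field"
  assumes "e \<noteq> f" "d \<noteq> e" "d \<noteq> f" "a \<noteq> e" "a \<noteq> f"
  shows "1 / (r * (d - e) * (e - f) * (f - a)) + 1 / (r * (d - f) * (f - e) * (e - a))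
    = (d - a) / (r * ((d - e) * (d - f) * (a - e) * (a - f)))"
\<comment> \<open>For \<open>r = 0\<close> both sides are 0, since division by zero yields
  0.\<close>
proof (cases "r = 0")
  case False
  \<comment> \<open>This is the claim cross-multiplied, with \<open>r\<close> and the common factors
    (d - e)(d - f) cancelled.\<close>
  have ring: "((d - f) * (f - e) * (e - a) + (d - e) * (e - f) * (f - a)) * ((a - e) * (a - f))
      = (d - a) * ((e - f) * (f - a) * (f - e) * (e - a))"
    by (simp add: algebra_simps)
  have nz: "d - e \<noteq> 0" "d - f \<noteq> 0" "e - f \<noteq> 0" "f - e \<noteq> 0" "f - a \<noteq> 0" "e - a \<noteq> 0"
    "a - e \<noteq> 0" "a - f \<noteq> 0"
    using assms by auto
  show ?thesis
    using nz False ring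
    by (simp add: add_divide_eq_iff divide_add_eq_iff divide_eq_eq eq_divide_eq mult.assoc)
qed simp

text \<open>Divisibility is visible termwise: at x1 = x6 the first product cancels the third and the
  second the fourth; at x2 = x4 the first cancels the second and the third the fourth.\<close>

lemma sum_of_numerators:
  fixes x1 x2 x3 x4 x5 x6 :: "'a::idom"
  shows "- ((x1 - x4)^2 * (x1 - x2) * (x2 - x3) * (x2 - x5) * (x3 - x6) * (x4 - x6) * (x5 - x6))
    - (x1 - x2)^2 * (x1 - x4) * (x3 - x4) * (x4 - x5) * (x2 - x6) * (x3 - x6) * (x5 - x6)
    + (x4 - x6)^2 * (x1 - x3) * (x2 - x3) * (x1 - x4) * (x1 - x5) * (x2 - x5) * (x2 - x6)
    + (x2 - x6)^2 * (x1 - x2) * (x1 - x3) * (x3 - x4) * (x1 - x5) * (x4 - x5) * (x4 - x6)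
    = (x1 - x6) * (x2 - x4) * (x1 * x2 * x4 - x2 * x3 * x4 - x2 * x4 * x5 + x3 * x4 * x5
      - x1 * x4 * x6 + x2 * x4 * x6 - x1 * x3 * x5 + x2 * x3 * x5
      - x1 * x2 * x6 + x1 * x3 * x6 + x1 * x5 * x6 - x3 * x5 * x6)^2"
  by algebra

text \<open>Each \<open>dij\<close> will be xi - xj. Treating the differences as independent atoms
  makes this mere clearing of denominators, with no expansion; the minus signs record factors
  traversed from larger to smaller index.\<close>

lemma sum_common_denominator:
  fixes d12 d13 d23 d14 d34 d15 d25 d45 d26 d36 d46 d56 d16 d24 :: "'a::field"
  assumes "d12 \<noteq> 0" "d13 \<noteq> 0" "d23 \<noteq> 0" "d14 \<noteq> 0" "d34 \<noteq> 0" "d15 \<noteq> 0" "d25 \<noteq> 0" "d45 \<noteq> 0"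
    "d26 \<noteq> 0" "d36 \<noteq> 0" "d46 \<noteq> 0" "d56 \<noteq> 0" "d16 \<noteq> 0" "d24 \<noteq> 0"
  shows "(- d14 / (d16 * - d26 * d24 * (- d34 * d45 * d13 * d15))
      + - d12 / (d16 * - d46 * - d24 * (d23 * d25 * d13 * d15)))
    + (d46 / (- d16 * d12 * d24 * (- d34 * d45 * - d36 * - d56))
      + d26 / (- d16 * d14 * - d24 * (d23 * d25 * - d36 * - d56)))
    = (- (d14^2 * d12 * d23 * d25 * d36 * d46 * d56)
      - d12^2 * d14 * d34 * d45 * d26 * d36 * d56
      + d46^2 * d13 * d23 * d14 * d15 * d25 * d26
      + d26^2 * d12 * d13 * d34 * d15 * d45 * d46)
      / (d16 * d24 * (d12 * d13 * d23 * d14 * d34 * d15 * d25 * d45 * d26 * d36 * d46 * d56))"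
    (is "(?t1 + ?t2) + (?t3 + ?t4) = _ / ?d")
proof -
  have "?t1 = - (d14^2 * d12 * d23 * d25 * d36 * d46 * d56) / ?d"
    "?t2 = - (d12^2 * d14 * d34 * d45 * d26 * d36 * d56) / ?d"
    "?t3 = d46^2 * d13 * d23 * d14 * d15 * d25 * d26 / ?d"
    "?t4 = d26^2 * d12 * d13 * d34 * d15 * d45 * d46 / ?d"
    using assms by (simp_all add: frac_eq_eq power2_eq_square mult_ac)
  then show ?thesis
    by (simp only: add_divide_distrib diff_conv_add_uminus minus_divide_left add.assoc)
qed

theorem mainTheorem1:
  fixes x1 x2 x3 x4 x5 x6 N D :: ratfun6
  defines "x1 \<equiv> indet 1" and "x2 \<equiv> indet 2" and "x3 \<equiv> indet 3"
    and "x4 \<equiv> indet 4" and "x5 \<equiv> indet 5" and "x6 \<equiv> indet 6"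
  defines "N \<equiv> x1 * x2 * x4 - x2 * x3 * x4 - x2 * x4 * x5 + x3 * x4 * x5
      - x1 * x4 * x6 + x2 * x4 * x6 - x1 * x3 * x5 + x2 * x3 * x5
      - x1 * x2 * x6 + x1 * x3 * x6 + x1 * x5 * x6 - x3 * x5 * x6"
    and "D \<equiv> (x1 - x2) * (x1 - x3) * (x2 - x3) * (x1 - x4) * (x3 - x4) * (x1 - x5)
      * (x2 - x5) * (x4 - x5) * (x2 - x6) * (x3 - x6) * (x4 - x6) * (x5 - x6)"
  shows "(\<Sum>\<sigma>\<in>perm_set. parke_taylor \<sigma>) = N\<^sup>2 / D"
proof -
  have indet_eq: "indet i = indet j \<longleftrightarrow> i = j" if "i \<in> {1..6}" "j \<in> {1..6}" for i j
    using inj_on_eq_iff[OF inj_on_indet that] .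
  \<comment> \<open>The value of two Parke-Taylor terms with first four entries \<open>a\<close>,
    \<open>b\<close>, \<open>c\<close>, \<open>d\<close>, summed over both orders of the block {3,
    5}.\<close>
  define q where "q a b c d = (d - a) / ((a - b) * (b - c) * (c - d) *
      ((d - x3) * (d - x5) * (a - x3) * (a - x5)))" for a b c d :: ratfun6
  have last: "parke_taylor (line_notation ((a, b), (c, d), (3, 5)))
      + parke_taylor (line_notation ((a, b), (c, d), (5, 3)))
      = q (indet a) (indet b) (indet c) (indet d)"
    if "a \<in> {1, 6}" "d \<in> {2, 4}" for a b c d
    unfolding parke_taylor_line_notation q_def x3_def x5_def
    by (rule sum_swap_last) (use that in \<open>auto simp: indet_eq\<close>)
  have nz: "x1 - x2 \<noteq> 0" "x1 - x3 \<noteq> 0" "x2 - x3 \<noteq> 0" "x1 - x4 \<noteq> 0" "x3 - x4 \<noteq> 0" "x1 - x5 \<noteq> 0"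
    "x2 - x5 \<noteq> 0" "x4 - x5 \<noteq> 0" "x2 - x6 \<noteq> 0" "x3 - x6 \<noteq> 0" "x4 - x6 \<noteq> 0" "x5 - x6 \<noteq> 0"
    "x1 - x6 \<noteq> 0" "x2 - x4 \<noteq> 0"
    by (simp_all add: x1_def x2_def x3_def x4_def x5_def x6_def indet_eq del: One_nat_def)
  \<comment> \<open>All differences are oriented from smaller to larger index, as in
    \<open>D\<close>, to match the atoms \<open>dij\<close>.\<close>
  have flip: "x4 - x1 = - (x1 - x4)" "x2 - x1 = - (x1 - x2)" "x6 - x2 = - (x2 - x6)"
    "x6 - x4 = - (x4 - x6)" "x4 - x2 = - (x2 - x4)" "x6 - x1 = - (x1 - x6)"
    "x4 - x3 = - (x3 - x4)" "x6 - x3 = - (x3 - x6)" "x6 - x5 = - (x5 - x6)"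
    by simp_all
  have "(\<Sum>\<sigma>\<in>perm_set. parke_taylor \<sigma>)
      = (\<Sum>(u, v, z)\<in>blocks. parke_taylor (line_notation (u, v, z)))"
    by (simp add: sum_perm_set case_prod_unfold)
  also have "\<dots> = (\<Sum>u\<in>{(1, 6), (6, 1)}. \<Sum>v\<in>{(2, 4), (4, 2)}. \<Sum>z\<in>{(3, 5), (5, 3)}.
      parke_taylor (line_notation (u, v, z)))"
    unfolding blocks_def by (simp only: sum.cartesian_product)
  \<comment> \<open>The innermost sum collapses to \<open>q\<close> by \<open>last\<close>, leaving
    one term for each order of {1, 6} and of {2, 4}.\<close>
  also have "\<dots> = (q x1 x6 x2 x4 + q x1 x6 x4 x2) + (q x6 x1 x2 x4 + q x6 x1 x4 x2)"
  proof -
    have two: "(\<Sum>w\<in>{(m, n), (n, m)}. F w) = F (m, n) + F (n, m)"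
      if "m \<noteq> n" for m n :: nat and F :: "nat \<times> nat \<Rightarrow> ratfun6"
      using that by simp
    have "(1::nat) \<noteq> 6" "(2::nat) \<noteq> 4" "(3::nat) \<noteq> 5"
      by simp_all
    then show ?thesis
      unfolding x1_def x2_def x4_def x6_def by (simp only: two last insert_iff simp_thms)
  qed
  also have "\<dots> = (x1 - x6) * (x2 - x4) * N^2 / ((x1 - x6) * (x2 - x4) * D)"
    unfolding q_def flip sum_common_denominator[OF nz] sum_of_numerators N_def D_def ..
  also have "\<dots> = N\<^sup>2 / D"
    using nz by simp
  finally show ?thesis .
qed

end
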